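(* Let $s,y\in\mathbb R^n$ with $s\neq0$ and $s^Ty<0$, put $\kappa=-s^Ty$, and let $B\in\mathbb R^{n\times n}$ be symmetric positive definite. Each vector $\widetilde y\in\{\widetilde y^{\mathrm N},\widetilde y^{\mathrm E},\widetilde y^{\mathrm H}\}$ satisfies $$s^T\widetilde y=\kappa=|s^Ty|>0.$$ Consequently, the matrix $$B^+(\widetilde y)=B-\frac{Bss^TB}{s^TBs}+\frac{\widetilde y\,\widetilde y^T}{s^T\widetilde y}$$ is symmetric positive definite and satisfies $B^+(\widetilde y)s=\widetilde y$. Equivalently, for $H=B^{-1}$ and $\rho=(s^T\widetilde y)^{-1}$, the inverse $H^+(\widetilde y)=B^+(\widetilde y)^{-1}$ is $$H^+(\widetilde y)=(I-\rho s\widetilde y^T)H(I-\rho\widetilde y s^T)+\rho ss^T.$$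
   Context: The three corrected vectors are: direct sign reflection $\widetilde y^{\mathrm N}:=-y$; the Euclidean nearest-point correction $\widetilde y^{\mathrm E}:=y-\frac{2s^Ty}{s^Ts}s$; the $B^{-1}$-metric nearest-point correction $\widetilde y^{\mathrm H}:=y-\frac{2s^Ty}{s^TBs}Bs$. *)

theory Defs
  imports "HOL-Analysis.Analysis"
begin

(* The rank-one matrix x y^T. *)
definition outer :: "real ^ 'm \<Rightarrow> real ^ 'n \<Rightarrow> real ^ 'n ^ 'm" where
  "outer x y = (\<chi> i j. x $ i * y $ j)"

definition sym_pos_def :: "real ^ 'n ^ 'n \<Rightarrow> bool" where
  "sym_pos_def A \<longleftrightarrow> transpose A = A \<and> (\<forall>x. x \<noteq> 0 \<longrightarrow> x \<bullet> (A *v x) > 0)"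

definition y_neg :: "real ^ 'n \<Rightarrow> real ^ 'n" where
  "y_neg y = - y"

definition y_eucl :: "real ^ 'n \<Rightarrow> real ^ 'n \<Rightarrow> real ^ 'n" where
  "y_eucl s y = y - (2 * (s \<bullet> y) / (s \<bullet> s)) *\<^sub>R s"

(* The correction of y that is nearest in the metric induced by the inverse of B;
   only B itself occurs in its closed form. *)
definition y_metric :: "real ^ 'n ^ 'n \<Rightarrow> real ^ 'n \<Rightarrow> real ^ 'n \<Rightarrow> real ^ 'n" where
  "y_metric B s y = y - (2 * (s \<bullet> y) / (s \<bullet> (B *v s))) *\<^sub>R (B *v s)"

(* The BFGS update of B for the step s and the (corrected) gradient difference v. *)
definition bfgs :: "real ^ 'n ^ 'n \<Rightarrow> real ^ 'n \<Rightarrow> real ^ 'n \<Rightarrow> real ^ 'n ^ 'n" where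
  "bfgs B s v = B - (1 / (s \<bullet> (B *v s))) *\<^sub>R (B ** outer s s ** B) + (1 / (s \<bullet> v)) *\<^sub>R outer v v"

end

theory Submission
  imports Defs
begin

text \<open>
  With \<open>p = x - ((s \<bullet> B x) / (s \<bullet> B s)) s\<close>, the quadratic form of the update at \<open>x\<close> is
  \<open>p \<bullet> B p + (v \<bullet> x)\<^sup>2 / (s \<bullet> v)\<close>: both terms are nonnegative, the first vanishes only if \<open>x\<close> is a
  multiple of \<open>s\<close>, and there the second is positive. The product form \<open>K\<close> of the inverse is checked
  to be a right inverse vector by vector. For \<open>w = z - \<rho> (s \<bullet> z) v\<close> one has \<open>s \<bullet> w = 0\<close>, so the
  first correction of the update vanishes at \<open>H w\<close>; \<open>K z\<close> differs from \<open>H w\<close> by a multiple of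
  \<open>s\<close>, on which the update acts by the secant equation.
\<close>

lemma outer_mult_vector: "outer x y *v z = (y \<bullet> z) *\<^sub>R x"
  by (simp add: vec_eq_iff outer_def matrix_vector_mult_def inner_vec_def sum_distrib_left
      mult.commute mult.left_commute)

lemma transpose_outer: "transpose (outer x y) = outer y x"
  by (simp add: vec_eq_iff outer_def transpose_def mult.commute)

lemma matrix_mult_inv_right:
  fixes A :: "'a::semiring_1 ^ 'n ^ 'm"
  assumes "invertible A"
  shows "A ** matrix_inv A = mat 1"
  using assms unfolding invertible_def matrix_inv_def by (rule someI2_ex) simp

text \<open>For square matrices over a field a right inverse is two-sided, so
  \<open>K ** A ** matrix_inv A\<close> collapses to either side.\<close>

lemma matrix_inv_eqI:
  fixes A K :: "'a::field ^ 'n ^ 'n"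
  assumes "A ** K = mat 1"
  shows "matrix_inv A = K"
proof -
  have KA: "K ** A = mat 1"
    using assms by (simp add: matrix_left_right_inverse)
  with assms have "A ** matrix_inv A = mat 1"
    by (intro matrix_mult_inv_right) (auto simp: invertible_def)
  then have "K ** A ** matrix_inv A = K"
    by (simp flip: matrix_mul_assoc)
  with KA show ?thesis by simp
qed

lemma symmetric_inner_mult:
  fixes A :: "real ^ 'n ^ 'n"
  assumes "transpose A = A"
  shows "x \<bullet> (A *v y) = (A *v x) \<bullet> y"
  by (metis assms dot_lmul_matrix transpose_matrix_vector)

text \<open>The kernel is trivial: \<open>A *v x = 0\<close> makes the quadratic form vanish at
  \<open>x\<close>, which forces \<open>x = 0\<close>.\<close>

lemma sym_pos_def_invertible:
  assumes "sym_pos_def A"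
  shows "invertible A"
  using assms unfolding sym_pos_def_def invertible_left_inverse matrix_left_invertible_ker
  by (metis inner_zero_right less_irrefl)

text \<open>Knowing the action on vectors reduces the secant equation, positivity and the inverse
  formula to computations with inner products.\<close>

lemma bfgs_mult_vector:
  "bfgs B s v *v x =
     B *v x - ((s \<bullet> (B *v x)) / (s \<bullet> (B *v s))) *\<^sub>R (B *v s) + ((v \<bullet> x) / (s \<bullet> v)) *\<^sub>R v"
  by (simp add: bfgs_def matrix_vector_mult_add_rdistrib matrix_vector_mult_diff_rdistrib
      outer_mult_vector matrix_vector_mult_scaleR
      flip: matrix_vector_mul_assoc scaleR_matrix_vector_assoc)

lemma transpose_bfgs:
  assumes "transpose B = B"
  shows "transpose (bfgs B s v) = bfgs B s v"
proof -
  have "transpose (B ** outer s s ** B) = B ** outer s s ** B"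
    by (simp add: matrix_transpose_mul transpose_outer assms matrix_mul_assoc)
  with assms transpose_outer[of v v] show ?thesis
    by (simp add: bfgs_def vec_eq_iff transpose_def)
qed

lemma bfgs_secant:
  assumes "s \<bullet> (B *v s) \<noteq> 0" and "s \<bullet> v \<noteq> 0"
  shows "bfgs B s v *v s = v"
  using assms by (simp add: bfgs_mult_vector inner_commute)

lemma sym_pos_def_bfgs:
  assumes B: "sym_pos_def B" and s: "s \<noteq> 0" and sv: "s \<bullet> v > 0"
  shows "sym_pos_def (bfgs B s v)"
  unfolding sym_pos_def_def
proof (intro conjI allI impI)
  have sym: "transpose B = B" and pos: "\<And>x. x \<noteq> 0 \<Longrightarrow> x \<bullet> (B *v x) > 0"
    using B by (auto simp: sym_pos_def_def)
  show "transpose (bfgs B s v) = bfgs B s v"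
    using sym by (rule transpose_bfgs)
  fix x :: "real ^ 'a"
  assume x: "x \<noteq> 0"
  \<comment> \<open>This \<open>c\<close> makes \<open>p\<close> the part of \<open>x\<close> that
    is \<open>B\<close>-orthogonal to \<open>s\<close>, that is,
    \<open>s \<bullet> (B *v p) = 0\<close>.\<close>
  define c where "c = (s \<bullet> (B *v x)) / (s \<bullet> (B *v s))"
  define p where "p = x - c *\<^sub>R s"
  have c: "c * (s \<bullet> (B *v s)) = s \<bullet> (B *v x)"
    using pos[OF s] by (simp add: c_def)
  have xs: "x \<bullet> (B *v s) = s \<bullet> (B *v x)"
    using symmetric_inner_mult[OF sym, of x s] by (simp add: inner_commute)
  have "p \<bullet> (B *v p) = x \<bullet> (B *v x) - c * (s \<bullet> (B *v x))"
    using c xs by (simp add: p_def matrix_vector_mult_diff_distrib matrix_vector_mult_scaleR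
        inner_diff_left inner_diff_right)
  moreover have "x \<bullet> (bfgs B s v *v x) =
      x \<bullet> (B *v x) - c * (s \<bullet> (B *v x)) + (v \<bullet> x)\<^sup>2 / (s \<bullet> v)"
    by (simp add: bfgs_mult_vector c_def xs inner_add_right inner_diff_right power2_eq_square
        inner_commute[of x v])
  ultimately have form: "x \<bullet> (bfgs B s v *v x) = p \<bullet> (B *v p) + (v \<bullet> x)\<^sup>2 / (s \<bullet> v)"
    by simp
  show "x \<bullet> (bfgs B s v *v x) > 0"
  proof (cases "p = 0")
    case True
    then have "x = c *\<^sub>R s" by (simp add: p_def)
    \<comment> \<open>Here \<open>c\<close> is nonzero because \<open>x\<close> is, and
      \<open>v \<bullet> x\<close> equals \<open>c * (s \<bullet> v)\<close>.\<close>
    with x sv have "v \<bullet> x \<noteq> 0" by (auto simp: inner_commute)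
    with sv True show ?thesis by (simp add: form)
  next
    case False
    then show ?thesis using pos sv by (simp add: form add_pos_nonneg)
  qed
qed

lemma matrix_inv_bfgs:
  fixes B :: "real ^ 'n ^ 'n"
  assumes B: "sym_pos_def B" and s: "s \<noteq> 0" and sv: "s \<bullet> v \<noteq> 0"
  defines "\<rho> \<equiv> inverse (s \<bullet> v)"
  shows "matrix_inv (bfgs B s v) =
    (mat 1 - \<rho> *\<^sub>R outer s v) ** matrix_inv B ** (mat 1 - \<rho> *\<^sub>R outer v s) + \<rho> *\<^sub>R outer s s"
    (is "_ = ?K")
proof -
  have sBs: "s \<bullet> (B *v s) \<noteq> 0"
    using B s by (auto simp: sym_pos_def_def dest!: spec[of _ s])
  have BH: "B ** matrix_inv B = mat 1"
    using sym_pos_def_invertible[OF B] by (rule matrix_mult_inv_right)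
  have "bfgs B s v *v (?K *v z) = z" for z
  proof -
    \<comment> \<open>The rightmost factor of \<open>?K\<close> sends \<open>z\<close> to
      \<open>w\<close>, and the choice of \<rho> makes \<open>w\<close> orthogonal to
      \<open>s\<close>.\<close>
    define w where "w = z - (\<rho> * (s \<bullet> z)) *\<^sub>R v"
    define u where "u = matrix_inv B *v w"
    have Bu: "B *v u = w"
      by (simp add: u_def matrix_vector_mul_assoc BH)
    have sw: "s \<bullet> w = 0"
      using sv by (simp add: w_def \<rho>_def inner_diff_right)
    have K: "?K *v z = u + (\<rho> * (s \<bullet> z) - \<rho> * (v \<bullet> u)) *\<^sub>R s"
      by (simp add: matrix_vector_mult_add_rdistrib matrix_vector_mult_diff_rdistrib
          outer_mult_vector scaleR_diff_left w_def u_def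
          flip: matrix_vector_mul_assoc scaleR_matrix_vector_assoc)
    have "bfgs B s v *v u = w + (\<rho> * (v \<bullet> u)) *\<^sub>R v"
      by (simp add: bfgs_mult_vector Bu sw \<rho>_def field_simps)
    \<comment> \<open>The multiple of \<open>s\<close> in \<open>?K *v z\<close> is sent to the same
      multiple of \<open>v\<close>. The terms with \<open>v \<bullet> u\<close> cancel, and what
      remains is \<open>w + (\<rho> * (s \<bullet> z)) *\<^sub>R v\<close>, which is
      \<open>z\<close>.\<close>
    then show ?thesis
      unfolding K using bfgs_secant[OF sBs sv]
      by (simp add: matrix_vector_right_distrib matrix_vector_mult_scaleR w_def algebra_simps)
  qed
  then have "bfgs B s v ** ?K = mat 1"
    by (simp add: matrix_eq matrix_vector_mul_assoc)
  then show ?thesis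
    by (rule matrix_inv_eqI)
qed

theorem proposition5p4:
  fixes s y :: "real ^ 'n" and B H :: "real ^ 'n ^ 'n" and \<kappa> :: real
  assumes "s \<noteq> 0"
    and "s \<bullet> y < 0"
    and "\<kappa> = - (s \<bullet> y)"
    and "sym_pos_def B"
    and "H = matrix_inv B"
  shows "\<forall>v \<in> {y_neg y, y_eucl s y, y_metric B s y}.
           s \<bullet> v = \<kappa> \<and> \<kappa> = \<bar>s \<bullet> y\<bar> \<and> \<bar>s \<bullet> y\<bar> > 0 \<and>
           sym_pos_def (bfgs B s v) \<and>
           bfgs B s v *v s = v \<and>
           invertible (bfgs B s v) \<and>
           (let \<rho> = inverse (s \<bullet> v) in
              matrix_inv (bfgs B s v) =
                (mat 1 - \<rho> *\<^sub>R outer s v) ** H ** (mat 1 - \<rho> *\<^sub>R outer v s) + \<rho> *\<^sub>R outer s s)"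
proof
  have sBs: "s \<bullet> (B *v s) \<noteq> 0"
    using assms(1,4) by (auto simp: sym_pos_def_def dest!: spec[of _ s])
  fix v
  assume "v \<in> {y_neg y, y_eucl s y, y_metric B s y}"
  \<comment> \<open>Each correction turns \<open>s \<bullet> y\<close> into its negative: the last
    two subtract a multiple of \<open>s\<close> or \<open>B *v s\<close> whose inner product with
    \<open>s\<close> is \<open>2 * (s \<bullet> y)\<close>.\<close>
  then have sv: "s \<bullet> v = \<kappa>"
    using assms(1,3) sBs by (auto simp: y_neg_def y_eucl_def y_metric_def inner_diff_right)
  with assms(2,3) have pos: "s \<bullet> v > 0" by simp
  have spd: "sym_pos_def (bfgs B s v)"
    using assms(4,1) pos by (rule sym_pos_def_bfgs)
  show "s \<bullet> v = \<kappa> \<and> \<kappa> = \<bar>s \<bullet> y\<bar> \<and> \<bar>s \<bullet> y\<bar> > 0 \<and>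
           sym_pos_def (bfgs B s v) \<and>
           bfgs B s v *v s = v \<and>
           invertible (bfgs B s v) \<and>
           (let \<rho> = inverse (s \<bullet> v) in
              matrix_inv (bfgs B s v) =
                (mat 1 - \<rho> *\<^sub>R outer s v) ** H ** (mat 1 - \<rho> *\<^sub>R outer v s) + \<rho> *\<^sub>R outer s s)"
    unfolding Let_def assms(5)
    using sv assms(2,3) spd sym_pos_def_invertible[OF spd] bfgs_secant[OF sBs, of v]
      matrix_inv_bfgs[OF assms(4,1), of v] pos
    by simp
qed

end
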